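(* For all natural numbers $n > m \geq 0$, \[ b_{n,m} = b_{n,m-1} + \sum_{k=1}^{n-m-1} b_{n-k,m-1} \binom{b_{m,m-1}}{k} + \binom{b_{m,m-1}}{n-m} \sum_{k=0}^m b_{k,k-1}, \] where $b_{0,-1} = 1$ and $b_{n,-1} = 0$ for all $n \geq 1$, and where $\binom{a}{b} = 0$ if $a < b$.
   Context: The adjunctive hierarchy of hereditarily finite sets is defined by $A_0 := \{\emptyset\}$ and $A_{n+1} := \{\emptyset\} \cup \{ x \cup \{y\} : x, y \in A_n\}$, with the convention $A_n := \emptyset$ for integers $n < 0$. For all integers $n, m$, let $B_{n,m} := \{ x \in A_n \setminus A_{n-1} : x \subseteq A_m\}$ and $b_{n,m} := |B_{n,m}|$. (Thus $|A_n| = \sum_{k=0}^n b_{k,k-1}$.) *)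

theory Defs
  imports Main "HOL-Library.FSet"
begin

text \<open>
  Hereditarily finite sets: a value is determined by the finite set of its members, so
  equality of values is extensional equality and membership is well-founded.
\<close>

datatype hf = HF (members: "hf fset")

definition hf_empty :: hf where
  "hf_empty = HF {||}"

definition hf_adjoin :: "hf \<Rightarrow> hf \<Rightarrow> hf" where
  "hf_adjoin x y = HF (members x |\<union>| {|y|})"

primrec adj_level_nat :: "nat \<Rightarrow> hf set" where
  "adj_level_nat 0 = {hf_empty}"
| "adj_level_nat (Suc n) =
    {hf_empty} \<union> {hf_adjoin x y | x y. x \<in> adj_level_nat n \<and> y \<in> adj_level_nat n}"

text \<open>The levels are indexed by all integers, those of negative index being empty.\<close>

definition adj_level :: "int \<Rightarrow> hf set" where
  "adj_level n = (if n < 0 then {} else adj_level_nat (nat n))"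

definition adj_B :: "int \<Rightarrow> int \<Rightarrow> hf set" where
  "adj_B n m = {x \<in> adj_level n - adj_level (n - 1). fset (members x) \<subseteq> adj_level m}"

definition adj_b :: "int \<Rightarrow> int \<Rightarrow> nat" where
  "adj_b n m = card (adj_B n m)"

text \<open>Finiteness of the levels, so that the cardinality above is a genuine count.\<close>

lemma finite_adj_level_nat: "finite (adj_level_nat n)"
proof (induction n)
  case (Suc n)
  have "{hf_adjoin x y | x y. x \<in> adj_level_nat n \<and> y \<in> adj_level_nat n}
      = (\<lambda>(x, y). hf_adjoin x y) ` (adj_level_nat n \<times> adj_level_nat n)"
    by auto
  with Suc show ?case by simp
qed simp

lemma finite_adj_level: "finite (adj_level n)"
  by (simp add: adj_level_def finite_adj_level_nat)

lemma finite_adj_B: "finite (adj_B n m)"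
  by (simp add: adj_B_def finite_adj_level)

end

theory Submission
  imports Defs
begin

text \<open>
  Split a set \<open>x\<close> all of whose elements lie in $A_m$ into its part \<open>u\<close> inside $A_{m-1}$ and the set
  \<open>S\<close> of its $k$ elements in $A_m \setminus A_{m-1}$. Adjoining the elements of \<open>S\<close> last is optimal,
  so for $k \geq 1$ we have $x \in A_n$ iff $u \in A_{n-k}$ and $m \leq n - k$. Hence $x$ first
  appears at level $n$ iff either $k < n - m$ and \<open>u\<close> first appears at level $n - k$, or
  $k = n - m$ and $u \in A_m$. Summing over all \<open>S\<close> of each size gives the recurrence.
\<close>

section \<open>Passing between values and their finite sets of members\<close>

abbreviation elts :: "hf \<Rightarrow> hf set" where
  "elts x \<equiv> fset (members x)"

text \<open>Inverts \<open>elts\<close> on finite sets only: \<open>Abs_fset\<close> is unspecified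
  on infinite ones, hence the finiteness facts that accompany \<open>hf_of\<close>.\<close>

definition hf_of :: "hf set \<Rightarrow> hf" where
  "hf_of S = HF (Abs_fset S)"

lemma elts_hf_of [simp]: "finite S \<Longrightarrow> elts (hf_of S) = S"
  by (simp add: hf_of_def Abs_fset_inverse)

lemma hf_of_elts [simp]: "hf_of (elts x) = x"
  by (simp add: hf_of_def fset_inverse)

lemma hf_eqI: "elts x = elts y \<Longrightarrow> x = y"
  by (metis hf_of_elts)

lemma elts_hf_empty [simp]: "elts hf_empty = {}"
  by (simp add: hf_empty_def)

lemma elts_hf_adjoin [simp]: "elts (hf_adjoin x y) = insert y (elts x)"
  by (simp add: hf_adjoin_def)

section \<open>Levels\<close>

lemma adj_level_neg: "n < 0 \<Longrightarrow> adj_level n = {}"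
  by (simp add: adj_level_def)

text \<open>One equation serves n = 0 as well, since level -1 is empty and contributes no
  adjunctions.\<close>

lemma adj_level_rec:
  assumes "0 \<le> n"
  shows "adj_level n =
    insert hf_empty {hf_adjoin x y | x y. x \<in> adj_level (n - 1) \<and> y \<in> adj_level (n - 1)}"
proof (cases "nat n")
  case 0
  then have "n = 0" using assms by simp
  then show ?thesis by (simp add: adj_level_def)
next
  case (Suc k)
  then have "n = int (Suc k)" by simp
  then show ?thesis by (simp add: adj_level_def nat_add_distrib)
qed

lemma hf_empty_in_adj_level: "0 \<le> n \<Longrightarrow> hf_empty \<in> adj_level n"
  by (simp add: adj_level_rec)

lemma hf_adjoin_in_adj_level:
  assumes "x \<in> adj_level n" "y \<in> adj_level n"
  shows "hf_adjoin x y \<in> adj_level (n + 1)"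
proof -
  have "0 \<le> n" using assms adj_level_neg[of n] by force
  then show ?thesis using assms by (auto simp: adj_level_rec[of "n + 1"])
qed

lemma adj_level_nat_mono: "n \<le> m \<Longrightarrow> adj_level_nat n \<subseteq> adj_level_nat m"
proof (rule lift_Suc_mono_le[of adj_level_nat])
  show "adj_level_nat k \<subseteq> adj_level_nat (Suc k)" for k
  proof (induction k)
    case (Suc k)
    then show ?case unfolding adj_level_nat.simps(2) by blast
  qed simp
qed

lemma adj_level_mono: "n \<le> m \<Longrightarrow> adj_level n \<subseteq> adj_level m"
  by (simp add: adj_level_def adj_level_nat_mono)

text \<open>In a set formed by adjoining v to y, a member is either v itself, taken from the
  previous level, or a member of y, which by induction lies one level lower still.\<close>

lemma elts_subset_adj_level:
  assumes "x \<in> adj_level n"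
  shows "elts x \<subseteq> adj_level (n - 1)"
proof -
  have "x \<in> adj_level_nat n \<Longrightarrow> elts x \<subseteq> adj_level (int n - 1)" for x n
  proof (induction n arbitrary: x)
    case (Suc n)
    have "adj_level (int n - 1) \<subseteq> adj_level (int n)"
      by (rule adj_level_mono) simp
    moreover have "adj_level (int n) = adj_level_nat n"
      by (simp add: adj_level_def)
    ultimately show ?case using Suc by fastforce
  qed simp
  from this[of x "nat n"] show ?thesis
    using assms by (simp add: adj_level_def split: if_splits)
qed

section \<open>Splitting off the elements of largest rank\<close>

text \<open>Adjoin S one element at a time at a cost of one level each; by monotonicity the elements
  still waiting remain available.\<close>

lemma union_in_adj_level:
  assumes "finite S" "u \<in> adj_level n" "S \<subseteq> adj_level n"
  shows "hf_of (elts u \<union> S) \<in> adj_level (n + int (card S))"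
  using assms
proof (induction S rule: finite_induct)
  case (insert v S)
  have "hf_of (elts u \<union> insert v S) = hf_adjoin (hf_of (elts u \<union> S)) v"
    by (rule hf_eqI) (use insert.hyps in simp)
  moreover have "v \<in> adj_level (n + int (card S))"
    using insert.prems adj_level_mono[of n "n + int (card S)"] by auto
  ultimately show ?case
    using hf_adjoin_in_adj_level[of "hf_of (elts u \<union> S)" "n + int (card S)" v] insert
    by (simp add: algebra_simps)
qed simp

text \<open>Optimality of adjoining S last. The induction inspects the last adjoined element v. If v
  is in u, the adjunctions are reordered so that v precedes S; the bound on m is proved alongside
  because it makes this reordering possible.\<close>

lemma split_in_adj_level:
  assumes "x \<in> adj_level n" "elts x = elts u \<union> S" "elts u \<inter> S = {}" "S \<noteq> {}"
    and "elts u \<subseteq> adj_level m" "S \<inter> adj_level (m - 1) = {}"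
  shows "u \<in> adj_level (n - int (card S)) \<and> m \<le> n - int (card S)"
proof -
  have "x \<in> adj_level_nat n \<Longrightarrow> elts x = elts u \<union> S \<Longrightarrow> elts u \<inter> S = {} \<Longrightarrow> S \<noteq> {}
    \<Longrightarrow> elts u \<subseteq> adj_level m \<Longrightarrow> S \<inter> adj_level (m - 1) = {} \<Longrightarrow>
    u \<in> adj_level (int n - int (card S)) \<and> m \<le> int n - int (card S)" for x n u S
  proof (induction n arbitrary: x u S)
    case (Suc n)
    have lev: "adj_level_nat n = adj_level (int n)"
      by (simp add: adj_level_def)
    have fin: "finite S"
      using Suc.prems(2) by (metis finite_Un finite_fset)
    obtain y v where yv: "x = hf_adjoin y v" "y \<in> adj_level (int n)" "v \<in> adj_level (int n)"
      using Suc.prems lev by auto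
    have x: "insert v (elts y) = elts u \<union> S"
      using yv(1) Suc.prems(2) by simp
    consider "v \<in> elts y" | "v \<notin> elts y" "v \<in> S" | "v \<notin> elts y" "v \<in> elts u"
      using x by blast
    then show ?case
    proof cases
      case 1
      then have "elts y = elts u \<union> S" using x by auto
      then have *: "u \<in> adj_level (int n - int (card S))" "m \<le> int n - int (card S)"
        using Suc.IH[of y u S] Suc.prems yv lev by auto
      then show ?thesis
        using adj_level_mono[of "int n - int (card S)" "int (Suc n) - int (card S)"] by auto
    next
      case 2
      have y: "elts y = elts u \<union> (S - {v})" using 2 x Suc.prems(3) by auto
      have card: "card S = Suc (card (S - {v}))"
        using 2 fin by (metis card.remove)
      show ?thesis
      proof (cases "S - {v} = {}")
        \<comment> \<open>Here S = {v}, so the induction hypothesis, which asks for a nonempty set,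
          does not apply to \<open>S - {v}\<close>. Instead y is u itself, and v lies in level n but
          not in level m - 1, forcing m \<le> n.\<close>
        case True
        have "elts u = elts y" using y unfolding True by simp
        then have "u = y" by (rule hf_eqI)
        moreover have "m \<le> int n"
        proof (rule ccontr)
          assume "\<not> m \<le> int n"
          then have "v \<in> adj_level (m - 1)"
            using yv(3) adj_level_mono[of "int n" "m - 1"] by auto
          then show False using 2 Suc.prems(6) by auto
        qed
        ultimately show ?thesis using card True yv by simp
      next
        case False
        then have "u \<in> adj_level (int n - int (card (S - {v})))
            \<and> m \<le> int n - int (card (S - {v}))"
          using Suc.IH[of y u "S - {v}"] Suc.prems yv y lev by auto
        then show ?thesis using card by simp
      qed
    next
      case 3
      let ?u = "hf_of (elts u - {v})"
      have "elts y = elts ?u \<union> S" using 3 x Suc.prems(3) by auto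
      then have *: "?u \<in> adj_level (int n - int (card S))" "m \<le> int n - int (card S)"
        using Suc.IH[of y ?u S] Suc.prems yv lev by auto
      \<comment> \<open>Being a member of u, v lies in level m, hence in level n - |S| by the second
        half of the induction hypothesis. It can thus be adjoined to \<open>?u\<close> before
        S.\<close>
      have "v \<in> adj_level (int n - int (card S))"
        using 3 Suc.prems(5) adj_level_mono[OF *(2)] by auto
      moreover have "hf_adjoin ?u v = u"
        by (rule hf_eqI) (use 3 in auto)
      ultimately have "u \<in> adj_level (int n - int (card S) + 1)"
        using hf_adjoin_in_adj_level *(1) by metis
      then show ?thesis using *(2) by (simp add: algebra_simps)
    qed
  qed auto
  from this[of x "nat n" u S] show ?thesis
    using assms by (simp add: adj_level_def[of n] split: if_splits)
qed

text \<open>Joins the two bounds. For empty S the right-hand side would wrongly demand m \<le>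
  n.\<close>

lemma union_in_adj_level_iff:
  assumes "finite S" "S \<noteq> {}" "S \<subseteq> adj_level m - adj_level (m - 1)" "elts u \<subseteq> adj_level (m - 1)"
  shows "hf_of (elts u \<union> S) \<in> adj_level n \<longleftrightarrow>
    u \<in> adj_level (n - int (card S)) \<and> m \<le> n - int (card S)"
proof
  assume "hf_of (elts u \<union> S) \<in> adj_level n"
  moreover have "elts u \<subseteq> adj_level m"
    using assms(4) adj_level_mono[of "m - 1" m] by auto
  ultimately show "u \<in> adj_level (n - int (card S)) \<and> m \<le> n - int (card S)"
    using assms by (intro split_in_adj_level[of "hf_of (elts u \<union> S)"]) auto
next
  assume *: "u \<in> adj_level (n - int (card S)) \<and> m \<le> n - int (card S)"
  then have "S \<subseteq> adj_level (n - int (card S))"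
    using assms(3) adj_level_mono[of m "n - int (card S)"] by auto
  then show "hf_of (elts u \<union> S) \<in> adj_level n"
    using union_in_adj_level[of S u "n - int (card S)"] * assms(1) by simp
qed

section \<open>Counting\<close>

text \<open>The members of a set in level n lie in level n - 1 anyway.\<close>

lemma adj_B_self: "adj_B n (n - 1) = adj_level n - adj_level (n - 1)"
  using elts_subset_adj_level by (auto simp: adj_B_def)

lemma card_adj_level: "card (adj_level (int m)) = (\<Sum>k = 0..m. adj_b (int k) (int k - 1))"
proof (induction m)
  case 0
  show ?case by (simp add: adj_b_def adj_B_self[of 0, simplified] adj_level_neg)
next
  case (Suc m)
  have "adj_level (int m) \<subseteq> adj_level (int (Suc m))"
    by (rule adj_level_mono) simp
  then have "card (adj_level (int (Suc m))) =
      card (adj_level (int m)) + adj_b (int (Suc m)) (int (Suc m) - 1)"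
    unfolding adj_b_def adj_B_self
    by (simp add: card_Diff_subset finite_adj_level card_mono)
  then show ?case using Suc by simp
qed

text \<open>The possible parts inside level m - 1 when k elements lie outside it, for k \<le> n - m.
  At k = n - m all of level m is allowed, even sets that appeared earlier.\<close>

definition lower_parts :: "nat \<Rightarrow> nat \<Rightarrow> nat \<Rightarrow> hf set" where
  "lower_parts n m k =
    (if k = n - m then adj_level (int m) else adj_B (int n - int k) (int m - 1))"

lemma union_in_adj_B_iff:
  fixes n m :: nat
  assumes "m < n" "finite S" "S \<subseteq> adj_level (int m) - adj_level (int m - 1)"
    and u: "elts u \<subseteq> adj_level (int m - 1)"
  shows "hf_of (elts u \<union> S) \<in> adj_B (int n) (int m) \<longleftrightarrow>
    card S \<le> n - m \<and> u \<in> lower_parts n m (card S)"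
proof (cases "S = {}")
  case True
  have "elts u \<subseteq> adj_level (int m)"
    using u adj_level_mono[of "int m - 1" "int m"] by auto
  then show ?thesis
    using True u assms(1) by (auto simp: lower_parts_def adj_B_def)
next
  case False
  have sub: "elts u \<union> S \<subseteq> adj_level (int m)"
    using u assms(3) adj_level_mono[of "int m - 1" "int m"] by auto
  have *: "hf_of (elts u \<union> S) \<in> adj_level j \<longleftrightarrow>
    u \<in> adj_level (j - int (card S)) \<and> int m \<le> j - int (card S)" for j
    by (rule union_in_adj_level_iff) (use assms False in auto)
  have "hf_of (elts u \<union> S) \<in> adj_B (int n) (int m) \<longleftrightarrow>
      (u \<in> adj_level (int n - int (card S)) \<and> int m \<le> int n - int (card S)) \<and>
      \<not> (u \<in> adj_level (int n - 1 - int (card S)) \<and> int m \<le> int n - 1 - int (card S))"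
    unfolding adj_B_def using sub assms(2) by (simp add: *)
  \<comment> \<open>If |S| = n - m, the excluded case fails through its inequality alone, leaving
    only u in level m. If |S| is smaller, both inequalities hold and u must be new at level n -
    |S|.\<close>
  also have "\<dots> \<longleftrightarrow> card S \<le> n - m \<and> u \<in> lower_parts n m (card S)"
  proof (cases "card S = n - m")
    case True
    then have "int n - int (card S) = int m" using assms(1) by simp
    then show ?thesis using True by (simp add: lower_parts_def)
  next
    case False
    then show ?thesis
      using u assms(1) by (auto simp: lower_parts_def adj_B_def algebra_simps)
  qed
  finally show ?thesis .
qed

lemma lower_parts_elts:
  "u \<in> lower_parts n m k \<Longrightarrow> elts u \<subseteq> adj_level (int m - 1)"
  using elts_subset_adj_level by (auto simp: lower_parts_def adj_B_def split: if_splits)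

lemma finite_lower_parts: "finite (lower_parts n m k)"
  by (simp add: lower_parts_def finite_adj_level finite_adj_B)

lemma adj_b_eq_sum_lower_parts:
  fixes n m :: nat
  assumes "m < n"
  shows "adj_b (int n) (int m) =
    (\<Sum>k = 0..n - m. card (lower_parts n m k) * (adj_b (int m) (int m - 1) choose k))"
proof -
  define T where "T = adj_level (int m) - adj_level (int m - 1)"
  define I where "I = {S. S \<subseteq> T \<and> card S \<le> n - m}"
  have finT: "finite T" by (simp add: T_def finite_adj_level)
  have finI: "finite I" by (rule finite_subset[of _ "Pow T"]) (use finT in \<open>auto simp: I_def\<close>)
  have finS: "finite S" if "S \<subseteq> T" for S using that finT by (rule finite_subset)
  let ?f = "\<lambda>x. (elts x \<inter> T, hf_of (elts x - T))"
  let ?g = "\<lambda>(S, u). hf_of (elts u \<union> S)"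
  have disj: "elts u \<inter> T = {}" if "elts u \<subseteq> adj_level (int m - 1)" for u
    using that by (auto simp: T_def)
  \<comment> \<open>Cutting x along T loses nothing, and S and u can be read off their union because
    u has no members in T.\<close>
  have "bij_betw ?f (adj_B (int n) (int m)) (Sigma I (\<lambda>S. lower_parts n m (card S)))"
  proof (rule bij_betw_byWitness[where f' = ?g])
    show "\<forall>x \<in> adj_B (int n) (int m). ?g (?f x) = x"
    proof clarify
      fix x
      show "hf_of (elts (hf_of (elts x - T)) \<union> elts x \<inter> T) = x"
        by (rule hf_eqI) auto
    qed
    show "\<forall>p \<in> Sigma I (\<lambda>S. lower_parts n m (card S)). ?f (?g p) = p"
    proof (intro ballI, elim SigmaE)
      fix p S u
      assume p: "S \<in> I" "u \<in> lower_parts n m (card S)" "p = (S, u)"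
      then have "S \<subseteq> T" "elts u \<inter> T = {}" "finite S"
        using disj lower_parts_elts finS by (auto simp: I_def)
      then have "(elts u \<union> S) \<inter> T = S" "(elts u \<union> S) - T = elts u" by auto
      then show "?f (?g p) = p"
        using \<open>finite S\<close> p(3) by simp
    qed
    show "?f ` adj_B (int n) (int m) \<subseteq> Sigma I (\<lambda>S. lower_parts n m (card S))"
    proof (rule image_subsetI)
      fix x
      assume x: "x \<in> adj_B (int n) (int m)"
      let ?S = "elts x \<inter> T" and ?u = "hf_of (elts x - T)"
      have "elts ?u \<union> ?S = elts x" by auto
      then have "hf_of (elts ?u \<union> ?S) = x" by simp
      moreover have "elts ?u \<subseteq> adj_level (int m - 1)"
        using x by (auto simp: adj_B_def T_def)
      moreover have "?S \<subseteq> T" "finite ?S" by auto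
      ultimately have "card ?S \<le> n - m" "?u \<in> lower_parts n m (card ?S)"
        using union_in_adj_B_iff[OF assms, of ?S ?u] x unfolding T_def by simp_all
      then show "?f x \<in> Sigma I (\<lambda>S. lower_parts n m (card S))"
        by (simp add: I_def)
    qed
    show "?g ` Sigma I (\<lambda>S. lower_parts n m (card S)) \<subseteq> adj_B (int n) (int m)"
    proof clarify
      fix S u
      assume *: "S \<in> I" "u \<in> lower_parts n m (card S)"
      then show "hf_of (elts u \<union> S) \<in> adj_B (int n) (int m)"
        using union_in_adj_B_iff[OF assms, of S u] lower_parts_elts finS
        by (auto simp: I_def T_def)
    qed
  qed
  then have "adj_b (int n) (int m) = (\<Sum>S\<in>I. card (lower_parts n m (card S)))"
    unfolding adj_b_def by (simp add: bij_betw_same_card finI finite_lower_parts)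
  \<comment> \<open>The number of choices for u depends only on |S|, so grouping by size produces
    the binomial coefficients.\<close>
  also have "\<dots> = (\<Sum>k = 0..n - m. \<Sum>S\<in>{S \<in> I. card S = k}. card (lower_parts n m (card S)))"
    by (rule sum.group[symmetric, OF finI]) (auto simp: I_def)
  also have "\<dots> = (\<Sum>k = 0..n - m. card (lower_parts n m k) * (card T choose k))"
  proof (rule sum.cong[OF refl])
    fix k
    assume "k \<in> {0..n - m}"
    then have "{S \<in> I. card S = k} = {S. S \<subseteq> T \<and> card S = k}" by (auto simp: I_def)
    then have "card {S \<in> I. card S = k} = card T choose k"
      using n_subsets[OF finT] by simp
    then show "(\<Sum>S\<in>{S \<in> I. card S = k}. card (lower_parts n m (card S))) =
        card (lower_parts n m k) * (card T choose k)"
      by simp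
  qed
  also have "card T = adj_b (int m) (int m - 1)"
    by (simp add: adj_b_def adj_B_self T_def)
  finally show ?thesis .
qed

theorem theorem1:
  "adj_b 0 (-1) = 1 \<and>
   (\<forall>n::nat. n \<ge> 1 \<longrightarrow> adj_b (int n) (-1) = 0) \<and>
   (\<forall>n m :: nat. n > m \<longrightarrow>
      adj_b (int n) (int m) =
        adj_b (int n) (int m - 1)
        + (\<Sum>k = 1..n - m - 1. adj_b (int n - int k) (int m - 1) * (adj_b (int m) (int m - 1) choose k))
        + (adj_b (int m) (int m - 1) choose (n - m)) * (\<Sum>k = 0..m. adj_b (int k) (int k - 1)))"
proof (intro conjI allI impI)
  show "adj_b 0 (-1) = 1"
    using card_adj_level[of 0] by (simp add: adj_level_def)
next
  fix n :: nat
  assume "n \<ge> 1"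
  \<comment> \<open>Level -1 is empty, so only the empty set could be counted, and it is not new at
    a level n \<ge> 1.\<close>
  then have "hf_empty \<in> adj_level (int n - 1)"
    by (intro hf_empty_in_adj_level) simp
  moreover have "x = hf_empty" if "elts x = {}" for x
    by (rule hf_eqI) (use that in simp)
  ultimately have "adj_B (int n) (-1) = {}"
    by (auto simp: adj_B_def adj_level_neg)
  then show "adj_b (int n) (-1) = 0" by (simp add: adj_b_def)
next
  fix n m :: nat
  assume "n > m"
  define F where
    "F k = card (lower_parts n m k) * (adj_b (int m) (int m - 1) choose k)" for k
  \<comment> \<open>The two end indices differ because n > m, and they give the outer terms; for n =
    m + 1 the middle range is empty.\<close>
  have "{0..n - m} = insert 0 (insert (n - m) {1..n - m - 1})"
    using \<open>n > m\<close> by auto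
  then have "(\<Sum>k = 0..n - m. F k) = F 0 + (\<Sum>k = 1..n - m - 1. F k) + F (n - m)"
    using \<open>n > m\<close> by (auto simp: sum.insert_if)
  moreover have "F 0 = adj_b (int n) (int m - 1)"
    using \<open>n > m\<close> by (simp add: F_def lower_parts_def adj_b_def)
  moreover have "F (n - m) =
      (adj_b (int m) (int m - 1) choose (n - m)) * (\<Sum>k = 0..m. adj_b (int k) (int k - 1))"
    by (simp add: F_def lower_parts_def card_adj_level)
  moreover have "(\<Sum>k = 1..n - m - 1. F k) =
      (\<Sum>k = 1..n - m - 1. adj_b (int n - int k) (int m - 1) * (adj_b (int m) (int m - 1) choose k))"
    by (rule sum.cong) (auto simp: F_def lower_parts_def adj_b_def)
  ultimately show "adj_b (int n) (int m) =
        adj_b (int n) (int m - 1)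
        + (\<Sum>k = 1..n - m - 1. adj_b (int n - int k) (int m - 1) * (adj_b (int m) (int m - 1) choose k))
        + (adj_b (int m) (int m - 1) choose (n - m)) * (\<Sum>k = 0..m. adj_b (int k) (int k - 1))"
    using adj_b_eq_sum_lower_parts[OF \<open>n > m\<close>] by (simp add: F_def)
qed

end
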